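(* Let $q$ be a prime power, $n=2t$ with $t$ a positive integer, and let $s$ be a positive integer coprime to $n$. Let $\sigma$ be a generator of $\mathrm{Gal}(\mathbb{F}_{q^n}/\mathbb{F}_q)$ and let $\overline{\sigma}\in\mathrm{Gal}(\mathbb{F}_{q^{ns}}/\mathbb{F}_q)$ be an extension of $\sigma$, i.e. $\overline{\sigma}|_{\mathbb{F}_{q^n}}=\sigma$. Let $f(x)=\sum_{i=0}^{n-1} f_i x^{\sigma^i}\in\mathcal{L}_{n,\sigma}$, with $f_i\in\mathbb{F}_{q^n}$. Then $$\mathrm{rk}(\Psi_{\sigma,s}(f))=\mathrm{rk}(\Phi_{\sigma,s}(f)).$$
   Context: For a finite field extension $\mathbb{F}_{Q^n}/\mathbb{F}_Q$ of degree $n$ and a generator $\tau$ of $\mathrm{Gal}(\mathbb{F}_{Q^n}/\mathbb{F}_Q)$, $\mathcal{L}_{n,\tau}$ denotes the ring (under addition and composition) of $\tau$-polynomials $f(x)=\sum_{i=0}^{n-1}f_ix^{\tau^i}$ with $f_i\in\mathbb{F}_{Q^n}$. Each such $f$ is identified with the $\mathbb{F}_Q$-linear endomorphism $\alpha\mapsto\sum_{i=0}^{n-1}f_i\tau^i(\alpha)$ of $\mathbb{F}_{Q^n}$; this gives a ring isomorphism $\mathcal{L}_{n,\tau}\cong\mathrm{End}_{\mathbb{F}_Q}(\mathbb{F}_{Q^n})$. The rank $\mathrm{rk}(f)$ is the rank over $\mathbb{F}_Q$ of this endomorphism. With $\sigma,\overline{\sigma},s$ as in the claim, $\sigma^s$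 generates $\mathrm{Gal}(\mathbb{F}_{q^n}/\mathbb{F}_q)$ and $\overline{\sigma}^s$ generates $\mathrm{Gal}(\mathbb{F}_{q^{ns}}/\mathbb{F}_{q^s})$. Thus $\mathcal{L}_{n,\sigma^s}$ consists of $\mathbb{F}_q$-endomorphisms of $\mathbb{F}_{q^n}$ (rank taken over $\mathbb{F}_q$), and $\mathcal{L}_{n,\overline{\sigma}^s}$ consists of $\mathbb{F}_{q^s}$-endomorphisms of $\mathbb{F}_{q^{ns}}$ (rank taken over $\mathbb{F}_{q^s}$). Define $$\Psi_{\sigma,s}:\mathcal{L}_{n,\sigma}\to\mathcal{L}_{n,\overline{\sigma}^s},\quad \sum_{i=0}^{n-1} f_ix^{\sigma^i}\mapsto\sum_{i=0}^{n-1} f_ix^{\overline{\sigma}^{si}},\qquad \Phi_{\sigma,s}:\mathcal{L}_{n,\sigma}\to\mathcal{L}_{n,\sigma^s},\quad \sum_{i=0}^{n-1} f_ix^{\sigma^i}\mapsto\sum_{i=0}^{n-1} f_ix^{\sigma^{si}}.$$ *)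

theory Defs
  imports "HOL-Algebra.Algebra" "HOL-Number_Theory.Prime_Powers"
begin

(* Ring automorphisms of E fixing K pointwise, under composition. As in HOL-Algebra.Bij,
   automorphisms are extensional, i.e. undefined outside carrier E. *)
definition Gal :: "('a, 'b) ring_scheme \<Rightarrow> 'a set \<Rightarrow> ('a \<Rightarrow> 'a) monoid"
  where "Gal E K = BijGroup (carrier E)
    \<lparr>carrier := {\<phi> \<in> Bij (carrier E). \<phi> \<in> ring_hom E E \<and> (\<forall>x\<in>K. \<phi> x = x)}\<rparr>"

definition Gal_generator :: "('a, 'b) ring_scheme \<Rightarrow> 'a set \<Rightarrow> ('a \<Rightarrow> 'a) \<Rightarrow> bool"
  where "Gal_generator E K \<tau> \<longleftrightarrow>
    \<tau> \<in> carrier (Gal E K) \<and> generate (Gal E K) {\<tau>} = carrier (Gal E K)"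

(* Tau_Poly \<tau> f is the formal expression \<Sum>i<n. f_i x^(\<tau>^i); the number n of
   coefficients is fixed by tau_polys. *)
datatype 'a tau_poly = Tau_Poly (tau: "'a \<Rightarrow> 'a") (coeff: "nat \<Rightarrow> 'a")

(* The set underlying the ring L_{n,\<tau>} over E. Addition and composition, which play no
   role for Psi, Phi and the rank, are those of the maps tau_eval. *)
definition tau_polys :: "('a, 'b) ring_scheme \<Rightarrow> nat \<Rightarrow> ('a \<Rightarrow> 'a) \<Rightarrow> 'a tau_poly set"
  where "tau_polys E n \<tau> = Tau_Poly \<tau> ` ({..<n} \<rightarrow>\<^sub>E carrier E)"

definition tau_eval :: "('a, 'b) ring_scheme \<Rightarrow> nat \<Rightarrow> 'a tau_poly \<Rightarrow> 'a \<Rightarrow> 'a"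
  where "tau_eval E n f =
    (\<lambda>\<alpha>\<in>carrier E. \<Oplus>\<^bsub>E\<^esub>i\<in>{..<n}. coeff f i \<otimes>\<^bsub>E\<^esub> (tau f ^^ i) \<alpha>)"

(* Rank over the subfield K of the K-linear endomorphism tau_eval E n f of E. *)
definition tau_rank :: "('a, 'b) ring_scheme \<Rightarrow> 'a set \<Rightarrow> nat \<Rightarrow> 'a tau_poly \<Rightarrow> nat"
  where "tau_rank E K n f = ring.dim E K (tau_eval E n f ` carrier E)"

(* \<Sum> f_i x^(\<sigma>^i) |-> \<Sum> f_i x^(\<sigma>'^(s i)), where \<sigma>' in Gal L K extends \<sigma> to the larger field L. *)
definition Psi :: "('a, 'b) ring_scheme \<Rightarrow> 'a set \<Rightarrow> ('a \<Rightarrow> 'a) \<Rightarrow> nat \<Rightarrow> 'a tau_poly \<Rightarrow> 'a tau_poly"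
  where "Psi L K \<sigma>' s f = Tau_Poly (\<sigma>' [^]\<^bsub>Gal L K\<^esub> s) (coeff f)"

(* \<Sum> f_i x^(\<sigma>^i) |-> \<Sum> f_i x^(\<sigma>^(s i)), with \<sigma> = tau f in Gal E K. *)
definition Phi :: "('a, 'b) ring_scheme \<Rightarrow> 'a set \<Rightarrow> nat \<Rightarrow> 'a tau_poly \<Rightarrow> 'a tau_poly"
  where "Phi E K s f = Tau_Poly (tau f [^]\<^bsub>Gal E K\<^esub> s) (coeff f)"

end

theory Submission
  imports Defs
begin

text \<open>
  On \<open>F\<^sub>q\<^sub>n\<close> the map \<open>\<Psi>(f)\<close> restricts to \<open>\<Phi>(f)\<close>, and it is linear over \<open>F\<^sub>q\<^sub>s\<close> because the \<open>s\<close>-th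
  power of any automorphism over \<open>F\<^sub>q\<close> is trivial on \<open>F\<^sub>q\<^sub>s\<close>. As \<open>s\<close> and \<open>n\<close> are coprime, the large field
  is \<open>F\<^sub>q\<^sub>n \<otimes> F\<^sub>q\<^sub>s\<close> over \<open>F\<^sub>q\<close>, so \<open>\<Psi>(f) = \<Phi>(f) \<otimes> id\<close>: a basis over \<open>F\<^sub>q\<close> of the image of \<open>\<Phi>(f)\<close> is
  a basis over \<open>F\<^sub>q\<^sub>s\<close> of the image of \<open>\<Psi>(f)\<close>.
\<close>

section \<open>Counting in vector spaces over a finite subfield\<close>

lemma (in ring) card_dimension:
  assumes "subfield K R" "finite K" "dimension m K V"
  shows "card V = card K ^ m"
proof -
  obtain Vs where Vs: "set Vs \<subseteq> carrier R" "independent K Vs" "length Vs = m" "Span K Vs = V"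
    using exists_base[OF assms(1,3)] by blast
  have "bij_betw (\<lambda>Ks. combine Ks Vs) {Ks. set Ks \<subseteq> K \<and> length Ks = m} V"
    unfolding bij_betw_def
  proof
    show "inj_on (\<lambda>Ks. combine Ks Vs) {Ks. set Ks \<subseteq> K \<and> length Ks = m}"
    proof (rule inj_onI, clarify)
      fix Ks Ks' assume *: "combine Ks Vs = combine Ks' Vs" "set Ks \<subseteq> K" "set Ks' \<subseteq> K"
        "m = length Ks" "length Ks' = length Ks"
      have "combine Ks Vs \<in> Span K Vs"
        using Span_mem_iff_length_version[OF assms(1) Vs(1)] * Vs(3) by auto
      from unique_decomposition[OF assms(1) Vs(2) this] * Vs(3) show "Ks = Ks'" by auto
    qed
    show "(\<lambda>Ks. combine Ks Vs) ` {Ks. set Ks \<subseteq> K \<and> length Ks = m} = V"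
      using Span_eq_combine_set_length_version[OF assms(1) Vs(1)] Vs(3,4) by auto
  qed
  then show ?thesis
    using bij_betw_same_card card_lists_length_eq[OF assms(2)] by metis
qed

text \<open>Coefficient lists map onto the span via \<open>combine\<close>. If the span is as large
  as the set of lists, this surjection of finite sets is injective, so only the zero list gives
  \<open>\<zero>\<close>.\<close>

lemma (in ring) card_Span_imp_independent:
  assumes "subfield K R" "finite K" "set Us \<subseteq> carrier R"
    and "card (Span K Us) = card K ^ length Us"
  shows "independent K Us"
proof (rule ccontr)
  let ?A = "{Ks. set Ks \<subseteq> K \<and> length Ks = length Us}"
  assume "\<not> independent K Us"
  then obtain Ks where Ks: "length Ks = length Us" "combine Ks Us = \<zero>" "set Ks \<subseteq> K" "set Ks \<noteq> {\<zero>}"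
    using dependent_imp_non_trivial_combine[OF assms(1,3)] by metis
  have "(\<lambda>Ks. combine Ks Us) ` ?A = Span K Us"
    using Span_eq_combine_set_length_version[OF assms(1,3)] by auto
  then have inj: "inj_on (\<lambda>Ks. combine Ks Us) ?A"
    using assms(4) card_lists_length_eq[OF assms(2)] finite_lists_length_eq[OF assms(2)]
    by (intro eq_card_imp_inj_on) auto
  have "Ks = replicate (length Us) \<zero>"
    using inj_onD[OF inj, of Ks "replicate (length Us) \<zero>"] Ks combine_replicate[OF assms(3)]
      subringE(2)[OF subfieldE(1)[OF assms(1)]] by (auto simp: set_replicate_conv_if)
  \<comment> \<open>A zero list of positive length would have entry set \<open>{\<zero>}\<close>,
    which the choice of \<open>Ks\<close> excludes. What remains is the empty list, which is
    independent.\<close>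
  then have "length Us = 0"
    using Ks(4) by (auto simp: set_replicate_conv_if split: if_splits)
  then show False
    using \<open>\<not> independent K Us\<close> by simp
qed

text \<open>A list of all elements of the ring is a finite spanning list, and finite dimension
  passes to subspaces.\<close>

lemma (in ring) finite_imp_finite_dimension:
  assumes "subfield K R" "finite (carrier R)" "subalgebra K V R"
  shows "finite_dimension K V"
proof -
  obtain Us where Us: "set Us = carrier R"
    using finite_list[OF assms(2)] by blast
  have "Span K Us = carrier R"
    using Us Span_base_incl[OF assms(1), of Us] Span_in_carrier[OF subfieldE(3)[OF assms(1)], of Us] by auto
  then have "finite_dimension K (carrier R)"
    using Span_finite_dimension[OF assms(1), of Us] Us by auto
  then show ?thesis
    using subalbegra_incl_imp_finite_dimension[OF assms(1) _ assms(3) subalgebra_in_carrier[OF assms(3)]]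
    by blast
qed

section \<open>Subspaces, and passage to a subring\<close>

text \<open>Closure of \<open>V\<close> under negation comes from scaling by
  \<open>\<ominus> \<one>\<close>, so closure under addition and scalars suffices.\<close>

lemma (in ring) subalgebraI:
  assumes "K \<subseteq> carrier R" "\<ominus> \<one> \<in> K" "V \<subseteq> carrier R" "\<zero> \<in> V"
    and "\<And>x y. x \<in> V \<Longrightarrow> y \<in> V \<Longrightarrow> x \<oplus> y \<in> V"
    and "\<And>k x. k \<in> K \<Longrightarrow> x \<in> V \<Longrightarrow> k \<otimes> x \<in> V"
  shows "subalgebra K V R"
proof (intro subalgebra.intro subalgebra_axioms.intro add.subgroupI)
  fix x assume x: "x \<in> V"
  then have "\<ominus> \<one> \<otimes> x = \<ominus> x" using assms(3) by (simp add: l_minus subsetD)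
  then show "\<ominus> x \<in> V" using assms(6)[OF assms(2) x] by simp
qed (use assms in auto)

lemma (in ring) independent_subring_consistent:
  assumes "subring F R" "set Us \<subseteq> F" "independent K Us"
  shows "ring.independent (R\<lparr>carrier := F\<rparr>) K Us"
  using assms(3,2)
proof (induction K Us rule: independent.induct)
  case li_Nil
  show ?case using ring.li_Nil[OF subring_is_ring[OF assms(1)]] by blast
next
  case (li_Cons u K Us)
  then show ?case using ring.li_Cons[OF subring_is_ring[OF assms(1)]] Span_consistent[OF assms(1)]
    by simp
qed

text \<open>The rank over the small field is a dimension computed in the ring with carrier
  \<open>F\<close>, whereas the linear algebra takes place in the large ring. This lemma links the
  two.\<close>

lemma (in ring) dimension_subring_consistent:
  assumes "subfield K R" "subring F R" "V \<subseteq> F" "dimension m K V"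
  shows "ring.dimension (R\<lparr>carrier := F\<rparr>) m K V"
proof -
  obtain Vs where Vs: "set Vs \<subseteq> carrier R" "independent K Vs" "length Vs = m" "Span K Vs = V"
    using exists_base[OF assms(1,4)] by blast
  have "ring.independent (R\<lparr>carrier := F\<rparr>) K Vs"
    using independent_subring_consistent[OF assms(2) _ Vs(2)]
      Span_base_incl[OF assms(1) Vs(1)] Vs(4) assms(3) by auto
  from ring.dimension_independent[OF subring_is_ring[OF assms(2)] this] show ?thesis
    using Vs Span_consistent[OF assms(2)] by simp
qed

lemma (in ring) finsum_subring_consistent:
  assumes "subring F R" "finite I" "f \<in> I \<rightarrow> F"
  shows "finsum (R\<lparr>carrier := F\<rparr>) f I = finsum R f I"
  using assms(2,3)
proof (induction I)
  case empty
  then show ?case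
    using abelian_monoid.finsum_empty[of "R\<lparr>carrier := F\<rparr>"] subring_is_ring[OF assms(1)]
    by (simp add: ring_def abelian_group_def)
next
  case (insert i I)
  interpret F: ring "R\<lparr>carrier := F\<rparr>" using subring_is_ring[OF assms(1)] .
  have "f \<in> I \<rightarrow> carrier R" "f i \<in> carrier R" "f \<in> I \<rightarrow> F" "f i \<in> F"
    using insert.prems subringE(1)[OF assms(1)] by auto
  then show ?case using insert F.finsum_insert[of I i f] by simp
qed

section \<open>Additivity of Frobenius powers\<close>

lemma (in cring) binomial_expansion:
  assumes [simp]: "x \<in> carrier R" "y \<in> carrier R"
  shows "(x \<oplus> y) [^] n = (\<Oplus>k\<in>{..n}. [(n choose k)] \<cdot>\<^bsub>R\<^esub> (x [^] k \<otimes> y [^] (n - k)))"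
proof (induction n)
  case 0
  then show ?case by simp
next
  case (Suc n)
  let ?t = "\<lambda>n k. x [^] k \<otimes> y [^] (n - k)"
  \<comment> \<open>The term for \<open>k = 0\<close> is split off so that Pascal's rule applies to
    all remaining indices \<open>Suc k\<close>. Of the two resulting sums, one is \<open>x\<close>
    times the expansion for \<open>n\<close>; the other, with the split-off term, is
    \<open>y\<close> times it.\<close>
  have "(\<Oplus>k\<in>{..Suc n}. [(Suc n choose k)] \<cdot>\<^bsub>R\<^esub> ?t (Suc n) k) =
      (\<Oplus>k\<in>{..n}. [(Suc n choose Suc k)] \<cdot>\<^bsub>R\<^esub> ?t (Suc n) (Suc k)) \<oplus> y [^] Suc n"
    by (subst finsum_Suc2) (auto simp del: binomial_Suc_Suc nat_pow_Suc)
  also have "(\<Oplus>k\<in>{..n}. [(Suc n choose Suc k)] \<cdot>\<^bsub>R\<^esub> ?t (Suc n) (Suc k)) =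
      (\<Oplus>k\<in>{..n}. [(n choose k)] \<cdot>\<^bsub>R\<^esub> ?t (Suc n) (Suc k)) \<oplus>
      (\<Oplus>k\<in>{..n}. [(n choose Suc k)] \<cdot>\<^bsub>R\<^esub> ?t (Suc n) (Suc k))"
    by (subst finsum_addf[symmetric]) (auto simp: add.nat_pow_mult simp del: nat_pow_Suc)
  also have "(\<Oplus>k\<in>{..n}. [(n choose k)] \<cdot>\<^bsub>R\<^esub> ?t (Suc n) (Suc k)) =
      x \<otimes> (\<Oplus>k\<in>{..n}. [(n choose k)] \<cdot>\<^bsub>R\<^esub> ?t n k)"
    by (subst finsum_rdistr) (auto intro!: finsum_cong' simp: add_pow_rdistr m_assoc m_comm m_lcomm)
  finally have *: "(\<Oplus>k\<in>{..Suc n}. [(Suc n choose k)] \<cdot>\<^bsub>R\<^esub> ?t (Suc n) k) =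
      x \<otimes> (\<Oplus>k\<in>{..n}. [(n choose k)] \<cdot>\<^bsub>R\<^esub> ?t n k) \<oplus>
      ((\<Oplus>k\<in>{..n}. [(n choose Suc k)] \<cdot>\<^bsub>R\<^esub> ?t (Suc n) (Suc k)) \<oplus> y [^] Suc n)"
    by (simp add: a_assoc del: nat_pow_Suc)
  also have "(\<Oplus>k\<in>{..n}. [(n choose Suc k)] \<cdot>\<^bsub>R\<^esub> ?t (Suc n) (Suc k)) \<oplus> y [^] Suc n =
      (\<Oplus>k\<in>{..Suc n}. [(n choose k)] \<cdot>\<^bsub>R\<^esub> ?t (Suc n) k)"
    by (subst finsum_Suc2) (auto simp del: nat_pow_Suc)
  \<comment> \<open>The top term vanishes because \<open>n choose Suc n\<close> is 0.\<close>
  also have "\<dots> = (\<Oplus>k\<in>{..n}. [(n choose k)] \<cdot>\<^bsub>R\<^esub> ?t (Suc n) k)"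
    by (subst finsum_Suc) (auto simp: binomial_eq_0 simp del: nat_pow_Suc)
  also have "\<dots> = y \<otimes> (\<Oplus>k\<in>{..n}. [(n choose k)] \<cdot>\<^bsub>R\<^esub> ?t n k)"
    by (subst finsum_rdistr)
      (auto intro!: finsum_cong' simp: add_pow_rdistr m_assoc m_comm m_lcomm Suc_diff_le)
  also have "x \<otimes> (\<Oplus>k\<in>{..n}. [(n choose k)] \<cdot>\<^bsub>R\<^esub> ?t n k) \<oplus> y \<otimes> (\<Oplus>k\<in>{..n}. [(n choose k)] \<cdot>\<^bsub>R\<^esub> ?t n k)
      = (x \<oplus> y) [^] Suc n"
    by (simp add: Suc.IH[symmetric] l_distr[symmetric] m_comm)
  finally show ?case ..
qed

text \<open>The inner binomial coefficients of a prime \<open>p\<close> are multiples of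
  \<open>p\<close> and vanish in characteristic \<open>p\<close>; iterating the case of exponent
  \<open>p\<close> gives \<open>p ^ j\<close>.\<close>

lemma (in cring) prime_power_sum:
  fixes p :: nat
  assumes p: "Factorial_Ring.prime p" and p0: "[p] \<cdot>\<^bsub>R\<^esub> \<one> = \<zero>" and [simp]: "x \<in> carrier R" "y \<in> carrier R"
  shows "(x \<oplus> y) [^] (p ^ j) = x [^] (p ^ j) \<oplus> y [^] (p ^ j)"
proof (induction j)
  case 0
  then show ?case by simp
next
  case (Suc j)
  have zero: "[m] \<cdot>\<^bsub>R\<^esub> z = \<zero>" if "p dvd m" and z: "z \<in> carrier R" for m z
  proof -
    obtain l where "m = p * l" using \<open>p dvd m\<close> by blast
    then have "[m] \<cdot>\<^bsub>R\<^esub> z = [l] \<cdot>\<^bsub>R\<^esub> ([p] \<cdot>\<^bsub>R\<^esub> \<one> \<otimes> z)"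
      using z by (simp add: add.nat_pow_pow add_pow_ldistr)
    then show ?thesis using p0 z by simp
  qed
  have prime: "(u \<oplus> v) [^] p = u [^] p \<oplus> v [^] p" if [simp]: "u \<in> carrier R" "v \<in> carrier R" for u v
  proof -
    \<comment> \<open>With this form of \<open>p\<close> the inner indices 1 to \<open>p - 1\<close>
      are exactly \<open>Suc k\<close> for \<open>k\<close> in \<open>{..m}\<close>.\<close>
    obtain m where m: "p = Suc (Suc m)"
      using prime_ge_2_nat[OF p] by (metis add_2_eq_Suc le_Suc_ex)
    have "(\<Oplus>k\<in>{..m}. [(p choose Suc k)] \<cdot>\<^bsub>R\<^esub> (u [^] Suc k \<otimes> v [^] (p - Suc k))) = \<zero>"
    proof (rule add.finprod_one_eqI)
      fix k assume "k \<in> {..m}"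
      then have "p dvd p choose Suc k"
        using m by (intro dvd_choose_prime[OF _ _ _ p]) auto
      then show "[(p choose Suc k)] \<cdot>\<^bsub>R\<^esub> (u [^] Suc k \<otimes> v [^] (p - Suc k)) = \<zero>"
        by (rule zero) simp
    qed
    then show ?thesis
      unfolding binomial_expansion[OF that]
      by (subst m, subst finsum_Suc, force, subst finsum_Suc2) (auto simp: m simp del: nat_pow_Suc)
  qed
  show ?case
    by (simp add: nat_pow_pow[symmetric] Suc.IH prime mult.commute[of p])
qed

text \<open>Lagrange in the additive group kills the multiple \<open>p ^ m\<close> of
  \<open>\<one>\<close>. This multiple is a power of the multiple \<open>p\<close> of
  \<open>\<one>\<close>, so integrality strips the factors one by one.\<close>

lemma (in domain) prime_characteristic:
  fixes p :: nat
  assumes "Factorial_Ring.prime p" "card (carrier R) = p ^ m"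
  shows "[p] \<cdot>\<^bsub>R\<^esub> \<one> = \<zero>"
proof -
  have "[(p ^ j)] \<cdot>\<^bsub>R\<^esub> \<one> = \<zero> \<Longrightarrow> [p] \<cdot>\<^bsub>R\<^esub> \<one> = \<zero>" for j
  proof (induction j)
    case (Suc j)
    have "[(p ^ Suc j)] \<cdot>\<^bsub>R\<^esub> \<one> = [p] \<cdot>\<^bsub>R\<^esub> \<one> \<otimes> [(p ^ j)] \<cdot>\<^bsub>R\<^esub> \<one>"
      by (simp add: add.nat_pow_pow add_pow_ldistr mult.commute)
    then show ?case using Suc integral by auto
  qed auto
  moreover have "[(p ^ m)] \<cdot>\<^bsub>R\<^esub> \<one> = \<zero>"
    using add.pow_order_eq_1[of \<one>] assms(2) by (simp add: order_def)
  ultimately show ?thesis by blast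
qed

section \<open>Subfields as solution sets of \<open>x [^] card K = x\<close>\<close>

lemma (in field) pow_card_eq_self:
  assumes "finite (carrier R)" "x \<in> carrier R"
  shows "x [^] card (carrier R) = x"
proof (cases "x = \<zero>")
  case True
  then show ?thesis using assms by (metis card_gt_0_iff empty_iff nat_pow_zero gr_implies_not_zero)
next
  case False
  have "x [^] (card (carrier R) - 1) = \<one>"
    using group.pow_order_eq_1[OF field_mult_group, of x] False assms order_mult_of[OF assms(1)]
    by (simp add: order_def nat_pow_def)
  moreover have "card (carrier R) = Suc (card (carrier R) - 1)"
    using assms by (metis Suc_pred' card_gt_0_iff empty_iff)
  ultimately show ?thesis using assms(2) by (metis nat_pow_Suc l_one)
qed

lemma (in field) subfield_pow_card_eq_self:
  assumes "subfield K R" "finite K" "x \<in> K"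
  shows "x [^] card K = x"
  using field.pow_card_eq_self[OF subfield_iff(2)[OF assms(1)], of x] assms
  by (simp flip: nat_pow_consistent)

lemma (in ring) two_le_card_subfield:
  assumes "subfield K R" "finite K"
  shows "2 \<le> card K"
proof -
  have "{\<zero>, \<one>} \<subseteq> K" "\<one> \<noteq> \<zero>"
    using subringE(2,3)[OF subfieldE(1)[OF assms(1)]] subfieldE(6)[OF assms(1)] by auto
  then show ?thesis using card_mono[OF assms(2), of "{\<zero>, \<one>}"] by auto
qed

text \<open>Every element of \<open>K\<close> is a solution, and the equation has at most
  \<open>card K\<close> solutions. Hence the order of a subfield determines it.\<close>

lemma (in field) subfield_eq_roots:
  assumes "finite (carrier R)" "subfield K R"
  shows "K = {x \<in> carrier R. x [^] card K = x}"
proof (rule card_seteq)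
  let ?R = "{x \<in> carrier R. x [^] (card K - 1) = \<one>}"
  have fin: "finite K" using assms subfieldE(3) finite_subset by blast
  note c = two_le_card_subfield[OF assms(2) fin]
  show "finite {x \<in> carrier R. x [^] card K = x}" using assms(1) by auto
  show "K \<subseteq> {x \<in> carrier R. x [^] card K = x}"
    using subfield_pow_card_eq_self[OF assms(2) fin] subfieldE(3)[OF assms(2)] by auto
  \<comment> \<open>Nonzero solutions satisfy \<open>x [^] (card K - 1) = \<one>\<close> by
    cancellation, and \<open>num_roots_le_deg\<close> bounds equations of this shape.\<close>
  have "{x \<in> carrier R. x [^] card K = x} \<subseteq> insert \<zero> ?R"
  proof
    fix x assume "x \<in> {x \<in> carrier R. x [^] card K = x}"
    then have x: "x \<in> carrier R" "x [^] card K = x" by auto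
    have "card K = Suc (card K - 1)" using c by simp
    then have "x [^] (card K - 1) \<otimes> x = x" using x(2) by (metis nat_pow_Suc)
    then have "x [^] (card K - 1) \<otimes> x = \<one> \<otimes> x" using x(1) by simp
    then show "x \<in> insert \<zero> ?R" using x m_rcancel[of x "x [^] (card K - 1)" \<one>] by auto
  qed
  then have "card {x \<in> carrier R. x [^] card K = x} \<le> card (insert \<zero> ?R)"
    using assms(1) by (intro card_mono) auto
  also have "\<dots> \<le> Suc (card ?R)" by (rule card_insert_le_m1) auto
  also have "\<dots> \<le> card K" using num_roots_le_deg[OF assms(1), of "card K - 1"] c by linarith
  finally show "card {x \<in> carrier R. x [^] card K = x} \<le> card K" .
qed

lemma (in field) subfield_pow_card_pow_eq_self:
  assumes "subfield K R" "finite K" "x \<in> K"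
  shows "x [^] (card K ^ i) = x"
proof -
  have "x \<in> carrier R" using subfieldE(3)[OF assms(1)] assms(3) by blast
  then show ?thesis
    using subfield_pow_card_eq_self[OF assms]
    by (induction i) (simp_all flip: nat_pow_pow add: mult.commute)
qed

text \<open>Elements of \<open>K\<close> are fixed by raising to the power
  \<open>card K ^ s\<close>, which is the equation that cuts out \<open>F\<close>.\<close>

lemma (in field) subfield_subset_if_card_pow:
  assumes "finite (carrier R)" "subfield K R" "subfield F R" "card F = card K ^ s"
  shows "K \<subseteq> F"
  using subfield_pow_card_pow_eq_self[OF assms(2)] subfield_eq_roots[OF assms(1,3)]
    subfieldE(3)[OF assms(2)] finite_subset[OF subfieldE(3)[OF assms(2)] assms(1)] assms(4) by auto

text \<open>If \<open>card K\<close> is a power of a prime \<open>p\<close>, so is the order of the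
  whole field, a vector space over \<open>K\<close>. Hence \<open>p\<close> annihilates
  \<open>\<one>\<close>, and \<open>card K ^ i\<close> is again a power of \<open>p\<close>.\<close>

lemma (in field) card_pow_sum:
  assumes "finite (carrier R)" "subfield K R" "primepow (card K)" "x \<in> carrier R" "y \<in> carrier R"
  shows "(x \<oplus> y) [^] (card K ^ i) = x [^] (card K ^ i) \<oplus> y [^] (card K ^ i)"
proof -
  obtain p k where p: "Factorial_Ring.prime p" "card K = p ^ k"
    using assms(3) by (auto simp: primepow_def)
  have fin: "finite K" using assms subfieldE(3) finite_subset by blast
  obtain d where "dimension d K (carrier R)"
    using finite_imp_finite_dimension[OF assms(2,1) carrier_is_subalgebra[OF subfieldE(3)[OF assms(2)]]]
    by blast
  from card_dimension[OF assms(2) fin this] p have "card (carrier R) = p ^ (k * d)"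
    by (simp add: power_mult)
  from prime_power_sum[OF p(1) prime_characteristic[OF p(1) this] assms(4,5), of "k * i"] p(2)
  show ?thesis by (simp add: power_mult)
qed

section \<open>Homomorphisms over \<open>K\<close> as Frobenius powers\<close>

lemma (in field) card_roots_le_degree:
  assumes "P \<in> carrier (poly_ring R)" "P \<noteq> []"
  shows "card {x \<in> carrier R. eval P x = \<zero>} \<le> degree P"
proof -
  have "{x \<in> carrier R. eval P x = \<zero>} = set_mset (roots P)"
    using roots_mem_iff_is_root[OF assms(1)] assms(2) by (auto simp: is_root_def)
  moreover have "card (set_mset (roots P)) \<le> size (roots P)"
    by (metis mset_set_set_mset_msubset size_mset_mono size_mset_set)
  ultimately show ?thesis using size_roots_le_degree[OF assms(1)] by simp
qed

lemma (in ring) subfield_is_subalgebra: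
  assumes "subfield K R" "subfield F R" "K \<subseteq> F"
  shows "subalgebra K F R"
proof -
  note F = subringE[OF subfieldE(1)[OF assms(2)]] and K = subringE[OF subfieldE(1)[OF assms(1)]]
  show ?thesis by (rule subalgebraI) (use F K assms(3) in auto)
qed

text \<open>
  A generator \<open>g\<close> of the multiplicative group of \<open>F\<close> is a root of a nonzero polynomial of degree at most
  \<open>s\<close> over \<open>K\<close>. Its \<open>s\<close> distinct Frobenius conjugates exhaust the roots, so \<open>h g\<close> is one of them.
\<close>
lemma (in field) hom_eq_Frobenius_on_subfield:
  assumes fin: "finite (carrier R)" and K: "subfield K R" and F: "subfield F R"
    and card: "card F = card K ^ s" and pp: "primepow (card K)"
    and h: "h \<in> ring_hom R R" "\<And>x. x \<in> K \<Longrightarrow> h x = x"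
  obtains i where "\<And>x. x \<in> F \<Longrightarrow> h x = x [^] (card K ^ i)"
proof -
  define q where "q = card K"
  have finK: "finite K" and finF: "finite F"
    using subfieldE(3)[OF K] subfieldE(3)[OF F] finite_subset[OF _ fin] by auto
  have q2: "2 \<le> q" unfolding q_def using two_le_card_subfield[OF K finK] .
  interpret F: field "R\<lparr>carrier := F\<rparr>" using subfield_iff(2)[OF F] .
  note KF = subfield_subset_if_card_pow[OF fin K F card]
  obtain g where g: "g \<in> F" "g \<noteq> \<zero>" and gen: "F - {\<zero>} = {g [^] i | i::nat. True}"
    using F.finite_field_mult_group_has_gen finF by (auto simp flip: nat_pow_consistent)
  have gR: "g \<in> carrier R" using g(1) subfieldE(3)[OF F] by auto

  \<comment> \<open>A coincidence of two conjugates would give \<open>g [^] d = \<one>\<close> for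
    some positive \<open>d < q ^ s - 1\<close>. Then all \<open>q ^ s - 1\<close> nonzero elements
    of \<open>F\<close>, being powers of \<open>g\<close>, would satisfy
    \<open>x [^] d = \<one>\<close>, which is too many.\<close>
  have inj: "inj_on (\<lambda>i. g [^] (q ^ i)) {..<s}"
  proof (rule linorder_inj_onI)
    fix i j assume ij: "i < j" "i \<in> {..<s}" "j \<in> {..<s}"
    show "g [^] (q ^ i) \<noteq> g [^] (q ^ j)"
    proof
      let ?d = "q ^ j - q ^ i"
      assume eq: "g [^] (q ^ i) = g [^] (q ^ j)"
      have lt: "q ^ i < q ^ j" "q ^ j < q ^ s" using ij q2 by auto
      have "g [^] (q ^ i) \<otimes> g [^] ?d = g [^] (q ^ i) \<otimes> \<one>"
        using eq lt gR nat_pow_mult[OF gR, of "q ^ i" ?d] by (simp only: le_add_diff_inverse less_imp_le) simp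
      then have "g [^] ?d = \<one>"
        using Units_l_cancel[OF Units_pow_closed[of g "q ^ i"], of "g [^] ?d" \<one>] gR g(2)
        by (simp add: field_Units)
      moreover have "(g [^] i) [^] ?d = (g [^] ?d) [^] i" for i :: nat
        using gR by (simp add: nat_pow_pow mult.commute)
      ultimately have "F - {\<zero>} \<subseteq> {x \<in> carrier R. x [^] ?d = \<one>}"
        unfolding gen using gR by auto
      then have "card (F - {\<zero>}) \<le> card {x \<in> carrier R. x [^] ?d = \<one>}"
        using fin by (intro card_mono) auto
      also have "\<dots> \<le> ?d" using num_roots_le_deg[OF fin, of ?d] lt by auto
      finally have "q ^ s - 1 \<le> ?d"
        using card subringE(2)[OF subfieldE(1)[OF F]] finF by (simp add: q_def)
      moreover have "0 < q ^ i" using q2 by simp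
      ultimately show False using lt by linarith
    qed
  qed auto

  obtain d where d: "dimension d K F"
    using finite_imp_finite_dimension[OF K fin subfield_is_subalgebra[OF K F KF]] by blast
  have ds: "d = s"
    using card_dimension[OF K finK d] card q2 by (simp add: q_def)
  have base: "set (exp_base g (Suc s)) \<subseteq> F"
    using F.exp_base_closed[of g "Suc s"] g(1)
    by (simp add: exp_base_def F.exp_base_def flip: nat_pow_consistent)
  \<comment> \<open>These are the powers of \<open>g\<close> from \<open>s\<close> down to 0, one
    vector more than the dimension of \<open>F\<close> over \<open>K\<close>. A linear relation
    between them is a polynomial vanishing at \<open>g\<close>.\<close>
  have "\<not> independent K (exp_base g (Suc s))"
    using independent_length_le_dimension[OF K d _ base] ds by (auto simp: exp_base_def)
  then obtain Ks where Ks': "length Ks = length (exp_base g (Suc s))"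
      "combine Ks (exp_base g (Suc s)) = \<zero>" "set Ks \<subseteq> K" "set Ks \<noteq> {\<zero>}"
    using dependent_imp_non_trivial_combine[OF K exp_base_closed[OF gR]] by blast
  then have "length Ks = Suc s" by (simp add: exp_base_def)
  with Ks' have Ks: "length Ks = Suc s" "set Ks \<subseteq> K" "set Ks \<noteq> {\<zero>}" "eval Ks g = \<zero>"
    using combine_eq_eval[of Ks g] by auto
  \<comment> \<open>The relation may begin with zero coefficients, but a nonempty member of
    \<open>poly_ring R\<close> has a nonzero leading coefficient.\<close>
  define P where "P = normalize Ks"
  have KsR: "set Ks \<subseteq> carrier R" using Ks(2) subfieldE(3)[OF K] by auto
  have P: "P \<in> carrier (poly_ring R)"
    unfolding P_def univ_poly_carrier[symmetric] using normalize_gives_polynomial[OF KsR] .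
  have "P \<noteq> []"
  proof
    assume "P = []"
    then have "Ks = replicate (length Ks) \<zero>"
      using normalize_def'(1)[of Ks] by (simp add: P_def)
    then have "set Ks = {\<zero>}" using Ks(1) set_replicate_Suc[of s \<zero>] by simp
    then show False using Ks(3) by simp
  qed
  have degP: "degree P \<le> s"
    using normalize_length_le[of Ks] Ks(1) by (simp add: P_def)
  \<comment> \<open>The coefficients lie in \<open>K\<close>, so a homomorphism fixing
    \<open>K\<close> sends the root \<open>g\<close> to a root. This is used both for the Frobenius
    powers and for \<open>h\<close>.\<close>
  have root: "\<psi> g \<in> {x \<in> carrier R. eval P x = \<zero>}"
    if \<psi>: "\<psi> \<in> ring_hom R R" "\<And>x. x \<in> K \<Longrightarrow> \<psi> x = x" for \<psi>
  proof -
    interpret \<psi>: ring_hom_ring R R \<psi>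
      using ring_hom_ringI2[OF ring_axioms ring_axioms \<psi>(1)] .
    have "map \<psi> Ks = Ks" using Ks(2) \<psi>(2) by (intro map_idI) auto
    then have "eval Ks (\<psi> g) = \<zero>"
      using \<psi>.eval_hom'[OF gR KsR] Ks(4) by simp
    then show ?thesis
      using eval_normalize[OF KsR] gR by (simp add: P_def)
  qed
  have Frob: "(\<lambda>x. x [^] (q ^ i)) \<in> ring_hom R R" for i
    using card_pow_sum[OF fin K pp, of _ _ i] nat_pow_distrib
    by (intro ring_hom_memI) (auto simp: q_def)
  \<comment> \<open>There are \<open>s\<close> distinct conjugates among at most
    \<open>degree P \<le> s\<close> roots, so there are no other roots.\<close>
  have "(\<lambda>i. g [^] (q ^ i)) ` {..<s} = {x \<in> carrier R. eval P x = \<zero>}"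
  proof (rule card_seteq)
    show "finite {x \<in> carrier R. eval P x = \<zero>}" using fin by simp
    show "(\<lambda>i. g [^] (q ^ i)) ` {..<s} \<subseteq> {x \<in> carrier R. eval P x = \<zero>}"
      using root[OF Frob] subfield_pow_card_pow_eq_self[OF K finK] unfolding q_def by auto
    show "card {x \<in> carrier R. eval P x = \<zero>} \<le> card ((\<lambda>i. g [^] (q ^ i)) ` {..<s})"
      using card_roots_le_degree[OF P \<open>P \<noteq> []\<close>] degP card_image[OF inj] by simp
  qed
  with root[OF h] have "h g \<in> (\<lambda>i. g [^] (q ^ i)) ` {..<s}" by simp
  then obtain i where i: "h g = g [^] (q ^ i)" by blast
  interpret h: ring_hom_ring R R h
    using ring_hom_ringI2[OF ring_axioms ring_axioms h(1)] .
  \<comment> \<open>Both sides are multiplicative, so agreement at the generator \<open>g\<close>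
    extends to all nonzero elements.\<close>
  have "h x = x [^] (q ^ i)" if "x \<in> F" for x
  proof (cases "x = \<zero>")
    case True
    then show ?thesis using q2 by (simp add: nat_pow_zero)
  next
    case False
    then have "x \<in> {g [^] i | i::nat. True}" unfolding gen[symmetric] using that by simp
    then obtain j :: nat where "x = g [^] j" by blast
    then show ?thesis using i gR by (simp add: h.hom_nat_pow nat_pow_pow mult.commute)
  qed
  then show ?thesis by (intro that[of i]) (simp add: q_def)
qed

text \<open>On \<open>F\<close> the map \<open>h\<close> is raising to some power
  \<open>card K ^ i\<close>. Its \<open>s\<close>-th iterate therefore raises to the power
  \<open>card F ^ i\<close>, which is the identity on \<open>F\<close>.\<close>

lemma (in field) hom_funpow_fixes_subfield:
  assumes fin: "finite (carrier R)" and K: "subfield K R" and F: "subfield F R"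
    and card: "card F = card K ^ s" and pp: "primepow (card K)"
    and h: "h \<in> ring_hom R R" "\<And>x. x \<in> K \<Longrightarrow> h x = x"
    and x: "x \<in> F"
  shows "(h ^^ s) x = x"
proof -
  obtain i where i: "\<And>x. x \<in> F \<Longrightarrow> h x = x [^] (card K ^ i)"
    using hom_eq_Frobenius_on_subfield[OF fin K F card pp h] by blast
  have xR: "x \<in> carrier R" using x subfieldE(3)[OF F] by auto
  interpret F: field "R\<lparr>carrier := F\<rparr>" using subfield_iff(2)[OF F] .
  have "(h ^^ m) x = x [^] (card K ^ (i * m))" for m
  proof (induction m)
    case 0
    then show ?case using xR by (simp add: nat_pow_eone)
  next
    case (Suc m)
    have "x [^] (card K ^ (i * m)) \<in> F"
      using F.nat_pow_closed[of x "card K ^ (i * m)"] x by (simp flip: nat_pow_consistent)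
    then have "(h ^^ Suc m) x = (x [^] (card K ^ (i * m))) [^] (card K ^ i)"
      using Suc i by simp
    also have "\<dots> = x [^] (card K ^ (i * m) * card K ^ i)"
      using xR by (rule nat_pow_pow)
    finally show ?case by (simp add: power_add mult.commute)
  qed
  then have "(h ^^ s) x = x [^] (card F ^ i)"
    by (metis card mult.commute power_mult)
  then show ?thesis
    using subfield_pow_card_pow_eq_self[OF F finite_subset[OF subfieldE(3)[OF F] fin] x] by simp
qed

section \<open>Linear disjointness of subfields of coprime degrees\<close>

text \<open>
  The span is a vector space over both \<open>F\<close> and \<open>G\<close>, so its dimension over \<open>K\<close> is a multiple of \<open>n * s\<close>.
\<close>
lemma (in field) Span_base_of_coprime_subfields:
  assumes fin: "finite (carrier R)" and K: "subfield K R" and F: "subfield F R" and G: "subfield G R"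
    and cardF: "card F = card K ^ n" and cardG: "card G = card K ^ s"
    and cardR: "card (carrier R) = card K ^ (n * s)" and cop: "coprime s n"
    and Us: "set Us \<subseteq> carrier R" "Span K Us = F"
  shows "Span G Us = carrier R"
proof -
  define M where "M = Span G Us"
  have finK: "finite K" and finF: "finite F" and finG: "finite G"
    using subfieldE(3)[OF K] subfieldE(3)[OF F] subfieldE(3)[OF G] finite_subset[OF _ fin] by auto
  have q2: "2 \<le> card K" using two_le_card_subfield[OF K finK] .
  have KG: "K \<subseteq> G" using subfield_subset_if_card_pow[OF fin K G cardG] .
  have subM: "subalgebra G M R"
    unfolding M_def using Span_is_subalgebra[OF G Us(1)] .
  have MR: "M \<subseteq> carrier R" using subalgebra_in_carrier[OF subM] .
  have FM: "F \<subseteq> M"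
    using Us(2) KG unfolding M_def Span_eq_combine_set[OF K Us(1)] Span_eq_combine_set[OF G Us(1)]
    by blast
  have UsF: "set Us \<subseteq> F" using Span_base_incl[OF K Us(1)] Us(2) by simp
  note M = Span_subgroup_props[OF G Us(1), folded M_def] Span_smult_closed[OF G Us(1), folded M_def]
  note Gp = subringE[OF subfieldE(1)[OF G]] and Fp = subringE[OF subfieldE(1)[OF F]]
  \<comment> \<open>The elements that \<open>a\<close> multiplies into \<open>M\<close> form a
    \<open>G\<close>-subspace. It contains \<open>Us\<close>, because \<open>F\<close> is closed
    under products and lies in \<open>M\<close>; hence it contains \<open>M\<close>.\<close>
  have smult: "a \<otimes> x \<in> M" if a: "a \<in> F" and x: "x \<in> M" for a x
  proof -
    have aR: "a \<in> carrier R" using a Fp(1) by auto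
    have "subalgebra G {x \<in> carrier R. a \<otimes> x \<in> M} R"
    proof (rule subalgebraI)
      fix k x assume *: "k \<in> G" "x \<in> {x \<in> carrier R. a \<otimes> x \<in> M}"
      then have "a \<otimes> (k \<otimes> x) = k \<otimes> (a \<otimes> x)" using aR Gp(1) by (auto intro: m_lcomm)
      then show "k \<otimes> x \<in> {x \<in> carrier R. a \<otimes> x \<in> M}" using * M(5) Gp(1) by auto
    qed (use Gp M aR in \<open>auto simp: r_distr\<close>)
    moreover have "set Us \<subseteq> {x \<in> carrier R. a \<otimes> x \<in> M}"
      using UsF FM Fp(6)[OF a] Us(1) by blast
    ultimately have "M \<subseteq> {x \<in> carrier R. a \<otimes> x \<in> M}"
      unfolding M_def by (rule subalgebra_Span_incl[OF G])
    then show ?thesis using x by blast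
  qed
  have "subalgebra F M R"
    by (rule subalgebraI) (use Fp M smult in auto)
  then obtain a where "dimension a F M"
    using finite_imp_finite_dimension[OF F fin] by blast
  then have a: "card M = card K ^ (n * a)"
    using card_dimension[OF F finF] cardF by (simp add: power_mult)
  obtain b where "dimension b G M"
    using finite_imp_finite_dimension[OF G fin subM] by blast
  then have b: "card M = card K ^ (s * b)"
    using card_dimension[OF G finG] cardG by (simp add: power_mult)
  \<comment> \<open>The order of \<open>M\<close> is counted once through \<open>F\<close> and once
    through \<open>G\<close>. Coprimality then forces \<open>s\<close> to divide
    \<open>a\<close>.\<close>
  have "n * a = s * b" using a b q2 by simp
  then have "s dvd n * a" by simp
  then have "n * s dvd n * a"
    using coprime_dvd_mult_right_iff[OF cop] by (intro mult_dvd_mono) auto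
  \<comment> \<open>Divisibility yields a lower bound only for a nonzero multiple; \<open>M\<close>
    is not the zero space since it contains \<open>F\<close>.\<close>
  moreover have "n * a \<noteq> 0"
  proof
    assume "n * a = 0"
    then have "card M = 1" using a by simp
    moreover have "card F \<le> card M" using card_mono[OF finite_subset[OF MR fin] FM] .
    ultimately show False using two_le_card_subfield[OF F finF] by simp
  qed
  ultimately have "n * s \<le> n * a" by (simp add: dvd_imp_le)
  then have "card (carrier R) \<le> card M" using a cardR q2 by (simp add: power_increasing)
  then show ?thesis using card_seteq[OF fin MR] by (simp add: M_def)
qed

text \<open>Extend \<open>Vs\<close> to a \<open>K\<close>-basis of \<open>F\<close>. Its
  \<open>n\<close> members span the whole field over \<open>G\<close>, whose order is
  \<open>card G ^ n\<close>, so counting makes them independent over \<open>G\<close>, and with them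
  the sublist \<open>Vs\<close>.\<close>

lemma (in field) independent_over_coprime_subfield:
  assumes fin: "finite (carrier R)" and K: "subfield K R" and F: "subfield F R" and G: "subfield G R"
    and cardF: "card F = card K ^ n" and cardG: "card G = card K ^ s"
    and cardR: "card (carrier R) = card K ^ (n * s)" and cop: "coprime s n"
    and Vs: "independent K Vs" "set Vs \<subseteq> F"
  shows "independent G Vs"
proof -
  have finK: "finite K" and finG: "finite G"
    using subfieldE(3)[OF K] subfieldE(3)[OF G] finite_subset[OF _ fin] by auto
  have q2: "2 \<le> card K" using two_le_card_subfield[OF K finK] .
  have KF: "K \<subseteq> F" using subfield_subset_if_card_pow[OF fin K F cardF] .
  obtain d where d: "dimension d K F"
    using finite_imp_finite_dimension[OF K fin subfield_is_subalgebra[OF K F KF]] by blast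
  have "d = n" using card_dimension[OF K finK d] cardF q2 by simp
  then obtain Ws where Ws: "length (Ws @ Vs) = n" "independent K (Ws @ Vs)" "Span K (Ws @ Vs) = F"
    using complete_base[OF K d Vs] by blast
  note in_carrier = independent_in_carrier[OF Ws(2)]
  have "Span G (Ws @ Vs) = carrier R"
    using Span_base_of_coprime_subfields[OF fin K F G cardF cardG cardR cop in_carrier Ws(3)] .
  then have "card (Span G (Ws @ Vs)) = card G ^ length (Ws @ Vs)"
    using Ws(1) cardR cardG by (simp add: power_mult mult.commute flip: power_mult)
  from card_Span_imp_independent[OF G finG in_carrier this]
  show ?thesis using independent_split(1)[OF G] by blast
qed

section \<open>Powers in the Galois group and iterates\<close>

lemma Gal_carrierD:
  assumes "\<tau> \<in> carrier (Gal E K)"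
  shows "\<tau> \<in> Bij (carrier E)" "\<tau> \<in> ring_hom E E" "\<And>x. x \<in> K \<Longrightarrow> \<tau> x = x"
  using assms by (auto simp: Gal_def)

text \<open>Group elements are extensional, so a group power matches the iterated function only on
  the carrier.\<close>

lemma Gal_nat_pow:
  assumes "\<tau> \<in> carrier (Gal E K)"
  shows "x \<in> carrier E \<Longrightarrow> (\<tau> [^]\<^bsub>Gal E K\<^esub> (m::nat)) x = (\<tau> ^^ m) x"
proof -
  have one: "\<one>\<^bsub>Gal E K\<^esub> = (\<lambda>x\<in>carrier E. x)"
    by (simp add: Gal_def BijGroup_def)
  have mult: "g \<otimes>\<^bsub>Gal E K\<^esub> h = compose (carrier E) g h"
    if "g \<in> Bij (carrier E)" "h \<in> Bij (carrier E)" for g h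
    using that by (simp add: Gal_def BijGroup_def)
  note \<tau> = Gal_carrierD(1)[OF assms]
  \<comment> \<open>Membership in \<open>Bij\<close> is carried through the induction because the
    product of \<open>BijGroup\<close> is \<open>compose\<close> only on bijections.\<close>
  have "\<tau> [^]\<^bsub>Gal E K\<^esub> m \<in> Bij (carrier E) \<and>
      (\<forall>x\<in>carrier E. (\<tau> [^]\<^bsub>Gal E K\<^esub> m) x = (\<tau> ^^ m) x)"
  proof (induction m)
    case 0
    have "\<tau> [^]\<^bsub>Gal E K\<^esub> (0::nat) = (\<lambda>x\<in>carrier E. x)" by (simp add: nat_pow_def one)
    with id_Bij[of "carrier E"] show ?case by (metis funpow_0 restrict_apply')
  next
    case (Suc m)
    have "\<tau> [^]\<^bsub>Gal E K\<^esub> Suc m = compose (carrier E) (\<tau> [^]\<^bsub>Gal E K\<^esub> m) \<tau>"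
      using mult[OF conjunct1[OF Suc] \<tau>] by (simp add: nat_pow_def)
    then show ?case
      using Suc \<tau> compose_Bij Bij_imp_funcset[OF \<tau>] by (auto simp: compose_eq funpow_swap1 Pi_iff)
  qed
  then show "x \<in> carrier E \<Longrightarrow> (\<tau> [^]\<^bsub>Gal E K\<^esub> m) x = (\<tau> ^^ m) x" by auto
qed

lemma funpow_eq_on:
  assumes "\<And>x. x \<in> A \<Longrightarrow> f x = g x" "\<And>x. x \<in> A \<Longrightarrow> g x \<in> A" "x \<in> A"
  shows "(f ^^ m) x = (g ^^ m) x \<and> (g ^^ m) x \<in> A"
  using assms by (induction m) auto

lemma (in ring) funpow_ring_hom:
  assumes "h \<in> ring_hom R R"
  shows "h ^^ m \<in> ring_hom R R"
proof (induction m)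
  case 0
  then show ?case by (auto intro: ring_hom_memI)
next
  case (Suc m)
  from ring_hom_trans[OF Suc assms] show ?case by (simp only: funpow.simps)
qed

section \<open>Comparison of the images over the two fields\<close>

lemma (in field) dim_image_eq_dim_image_subfield:
  assumes fin: "finite (carrier R)" and K: "subfield K R" and F: "subfield F R" and G: "subfield G R"
    and cardF: "card F = card K ^ n" and cardG: "card G = card K ^ s"
    and cardR: "card (carrier R) = card K ^ (n * s)" and cop: "coprime s n"
    and \<phi>R: "\<phi> \<in> carrier R \<rightarrow> carrier R" and \<phi>F: "\<phi> \<in> F \<rightarrow> F"
    and add: "\<And>x y. x \<in> carrier R \<Longrightarrow> y \<in> carrier R \<Longrightarrow> \<phi> (x \<oplus> y) = \<phi> x \<oplus> \<phi> y"
    and smult: "\<And>k x. k \<in> G \<Longrightarrow> x \<in> carrier R \<Longrightarrow> \<phi> (k \<otimes> x) = k \<otimes> \<phi> x"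
  shows "dim G (\<phi> ` carrier R) = ring.dim (R\<lparr>carrier := F\<rparr>) K (\<phi> ` F)"
proof -
  note Gp = subringE[OF subfieldE(1)[OF G]] and Fp = subringE[OF subfieldE(1)[OF F]]
    and Kp = subringE[OF subfieldE(1)[OF K]]
  have KF: "K \<subseteq> F" using subfield_subset_if_card_pow[OF fin K F cardF] .
  have KG: "K \<subseteq> G" using subfield_subset_if_card_pow[OF fin K G cardG] .
  have zero: "\<phi> \<zero> = \<zero>"
    using smult[OF Gp(2) zero_closed] \<phi>R by (simp add: Pi_iff)

  have subF: "subalgebra K (\<phi> ` F) R"
  proof (rule subalgebraI)
    show "\<phi> ` F \<subseteq> carrier R" using \<phi>F Fp(1) by auto
    show "\<zero> \<in> \<phi> ` F" using zero Fp(2) by (metis image_eqI)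
    show "u \<oplus> v \<in> \<phi> ` F" if "u \<in> \<phi> ` F" "v \<in> \<phi> ` F" for u v
      using that Fp(1,7) add by (auto simp: image_iff) (metis subsetD)
    show "k \<otimes> v \<in> \<phi> ` F" if "k \<in> K" "v \<in> \<phi> ` F" for k v
      using that Fp(1,6) smult KF KG by (auto simp: image_iff) (metis subsetD)
  qed (use Kp in auto)
  have subR: "subalgebra G (\<phi> ` carrier R) R"
  proof (rule subalgebraI)
    show "\<phi> ` carrier R \<subseteq> carrier R" using \<phi>R by auto
    show "\<zero> \<in> \<phi> ` carrier R" using zero by (metis image_eqI zero_closed)
    show "u \<oplus> v \<in> \<phi> ` carrier R" if "u \<in> \<phi> ` carrier R" "v \<in> \<phi> ` carrier R" for u v
      using that add by (auto simp: image_iff) (metis a_closed)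
    show "k \<otimes> v \<in> \<phi> ` carrier R" if "k \<in> G" "v \<in> \<phi> ` carrier R" for k v
      using that Gp(1) smult by (auto simp: image_iff) (metis m_closed subsetD)
  qed (use Gp in auto)

  obtain r where r: "dimension r K (\<phi> ` F)"
    using finite_imp_finite_dimension[OF K fin subF] by blast
  obtain Vs where Vs: "set Vs \<subseteq> carrier R" "independent K Vs" "length Vs = r" "Span K Vs = \<phi> ` F"
    using exists_base[OF K r] by blast
  have VsV: "set Vs \<subseteq> \<phi> ` F" using Span_base_incl[OF K Vs(1)] Vs(4) by simp
  have ind: "independent G Vs"
    using independent_over_coprime_subfield[OF fin K F G cardF cardG cardR cop Vs(2)] VsV \<phi>F by auto

  obtain d where d: "dimension d K F"
    using finite_imp_finite_dimension[OF K fin subfield_is_subalgebra[OF K F KF]] by blast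
  obtain Us where Us: "set Us \<subseteq> carrier R" "Span K Us = F"
    using exists_base[OF K d] by blast
  have UsF: "set Us \<subseteq> F" using Span_base_incl[OF K Us(1)] Us(2) by simp
  note SpanUs = Span_base_of_coprime_subfields[OF fin K F G cardF cardG cardR cop Us]

  have "Span G Vs \<subseteq> \<phi> ` carrier R"
    using subalgebra_Span_incl[OF G subR] VsV Fp(1) by blast
  \<comment> \<open>The preimage of \<open>Span G Vs\<close> under \<open>\<phi>\<close> is a
    \<open>G\<close>-subspace containing \<open>Us\<close>, and \<open>Us\<close> spans everything
    over \<open>G\<close>.\<close>
  moreover have "\<phi> ` carrier R \<subseteq> Span G Vs"
  proof -
    note S = Span_subgroup_props[OF G Vs(1)] Span_smult_closed[OF G Vs(1)]
    have FS: "\<phi> ` F \<subseteq> Span G Vs"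
      using Vs(4) KG Span_eq_combine_set[OF K Vs(1)] Span_eq_combine_set[OF G Vs(1)] by blast
    have "subalgebra G {x \<in> carrier R. \<phi> x \<in> Span G Vs} R"
      by (rule subalgebraI) (use Gp S zero add smult in auto)
    moreover have "set Us \<subseteq> {x \<in> carrier R. \<phi> x \<in> Span G Vs}"
      using UsF FS Us(1) by blast
    ultimately have "carrier R \<subseteq> {x \<in> carrier R. \<phi> x \<in> Span G Vs}"
      unfolding SpanUs[symmetric] by (rule subalgebra_Span_incl[OF G])
    then show ?thesis by blast
  qed
  ultimately have "dimension r G (\<phi> ` carrier R)"
    using dimensionI[OF G ind] Vs(3) by blast
  then have 1: "dim G (\<phi> ` carrier R) = r"
    using dimI[OF G] by (simp add: over_def)

  interpret F: field "R\<lparr>carrier := F\<rparr>" using subfield_iff(2)[OF F] .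
  have "subfield K (R\<lparr>carrier := F\<rparr>)"
    using F.subfield_iff(1)[of K] subfield_iff(2)[OF K] KF by simp
  moreover have "ring.dimension (R\<lparr>carrier := F\<rparr>) r K (\<phi> ` F)"
    using dimension_subring_consistent[OF K subfieldE(1)[OF F] _ r] \<phi>F by auto
  ultimately have "ring.dim (R\<lparr>carrier := F\<rparr>) K (\<phi> ` F) = r"
    using F.dimI by (simp add: over_def)
  with 1 show ?thesis by simp
qed

section \<open>The two rank computations\<close>

theorem theorem3p2:
  fixes q n t s :: nat
    and L (structure)
    and Fq Fqn Fqs :: "'a set"
    and \<sigma> \<sigma>' :: "'a \<Rightarrow> 'a"
    and f :: "'a tau_poly"
  defines "E \<equiv> L\<lparr>carrier := Fqn\<rparr>"
  assumes "primepow q"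
    and "n = 2 * t" and "t > 0"
    and "s > 0" and "coprime s n"
    and "field L" and "card (carrier L) = q ^ (n * s)"
    and "subfield Fq L" and "card Fq = q"
    and "subfield Fqn L" and "card Fqn = q ^ n"
    and "subfield Fqs L" and "card Fqs = q ^ s"
    and "Gal_generator E Fq \<sigma>"
    and "\<sigma>' \<in> carrier (Gal L Fq)" and "restrict \<sigma>' Fqn = \<sigma>"
    and "f \<in> tau_polys E n \<sigma>"
  shows "tau_rank L Fqs n (Psi L Fq \<sigma>' s f) = tau_rank E Fq n (Phi E Fq s f)"
proof -
  interpret field L by fact
  note Fq = \<open>subfield Fq L\<close> and Fqn = \<open>subfield Fqn L\<close> and Fqs = \<open>subfield Fqs L\<close>
  have carrier_E [simp]: "carrier E = Fqn" by (simp add: E_def)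
  have "q > 0" using \<open>primepow q\<close> by (simp add: primepow_gt_0_nat)
  then have fin: "finite (carrier L)"
    using \<open>card (carrier L) = q ^ (n * s)\<close> by (intro card_ge_0_finite) simp
  note FqnL = subfieldE(3)[OF Fqn]

  obtain c where f: "f = Tau_Poly \<sigma> c" and c: "c \<in> {..<n} \<rightarrow>\<^sub>E Fqn"
    using \<open>f \<in> tau_polys E n \<sigma>\<close> unfolding tau_polys_def carrier_E by blast
  have coeff: "c i \<in> Fqn" if "i < n" for i
    using PiE_mem[OF c] that by blast
  then have coeffL: "c i \<in> carrier L" if "i < n" for i
    using that FqnL by blast
  have \<sigma>: "\<sigma> \<in> carrier (Gal E Fq)"
    using \<open>Gal_generator E Fq \<sigma>\<close> by (simp add: Gal_generator_def)
  note \<sigma>' = \<open>\<sigma>' \<in> carrier (Gal L Fq)\<close>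
  have \<sigma>'_eq: "\<sigma> x = \<sigma>' x" if "x \<in> Fqn" for x
    using \<open>restrict \<sigma>' Fqn = \<sigma>\<close> that by auto

  \<comment> \<open>One plain iterate replaces both group powers: it agrees with the power of
    \<open>\<sigma>'\<close> on \<open>carrier L\<close> and with that of \<open>\<sigma>\<close> on
    \<open>Fqn\<close>. Hence a single map \<open>\<phi>\<close> describes both evaluations.\<close>
  define \<tau> where "\<tau> = \<sigma>' ^^ s"
  define \<phi> where "\<phi> \<alpha> = (\<Oplus>i\<in>{..<n}. c i \<otimes> (\<tau> ^^ i) \<alpha>)" for \<alpha>
  have \<tau>: "\<tau> \<in> ring_hom L L"
    unfolding \<tau>_def using funpow_ring_hom[OF Gal_carrierD(2)[OF \<sigma>']] .
  note \<tau>_pow = funpow_ring_hom[OF \<tau>]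
  note \<tau>_closed [simp] = ring_hom_closed[OF \<tau>_pow]
  \<comment> \<open>Scalars from \<open>Fqs\<close> thus pass through every
    \<open>\<tau> ^^ i\<close>, which makes \<open>\<phi>\<close> linear over
    \<open>Fqs\<close>.\<close>
  have \<tau>_fix: "(\<tau> ^^ i) x = x" if "x \<in> Fqs" for i x
  proof -
    have "\<tau> x = x"
      unfolding \<tau>_def
      by (rule hom_funpow_fixes_subfield[OF fin Fq Fqs _ _ Gal_carrierD(2,3)[OF \<sigma>'] that])
        (use assms in auto)
    then show ?thesis by (induction i) auto
  qed

  have PsiD: "tau_eval L n (Psi L Fq \<sigma>' s f) \<alpha> = \<phi> \<alpha>" if \<alpha>: "\<alpha> \<in> carrier L" for \<alpha>
  proof -
    have "((\<sigma>' [^]\<^bsub>Gal L Fq\<^esub> s) ^^ i) \<alpha> = (\<tau> ^^ i) \<alpha>" for i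
      using funpow_eq_on[of "carrier L" "\<sigma>' [^]\<^bsub>Gal L Fq\<^esub> s" \<tau> \<alpha> i] Gal_nat_pow[OF \<sigma>']
        ring_hom_closed[OF \<tau>] \<alpha> by (auto simp: \<tau>_def)
    then show ?thesis using \<alpha> by (simp add: tau_eval_def Psi_def f \<phi>_def)
  qed

  \<comment> \<open>Stability of \<open>Fqn\<close> under \<open>\<sigma>'\<close> is inherited from
    \<open>\<sigma>\<close>, an automorphism of \<open>E\<close> that agrees with
    \<open>\<sigma>'\<close> there.\<close>
  have \<sigma>_pow: "(\<sigma> ^^ m) x = (\<sigma>' ^^ m) x \<and> (\<sigma>' ^^ m) x \<in> Fqn" if "x \<in> Fqn" for x m
    by (rule funpow_eq_on[OF \<sigma>'_eq _ that])
      (use \<sigma>'_eq ring_hom_closed[OF Gal_carrierD(2)[OF \<sigma>]] in auto)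
  have \<tau>_Fqn: "((\<sigma> [^]\<^bsub>Gal E Fq\<^esub> s) ^^ i) \<alpha> = (\<tau> ^^ i) \<alpha> \<and> (\<tau> ^^ i) \<alpha> \<in> Fqn"
    if \<alpha>: "\<alpha> \<in> Fqn" for i \<alpha>
    by (rule funpow_eq_on[OF _ _ \<alpha>]) (use Gal_nat_pow[OF \<sigma>] \<sigma>_pow in \<open>auto simp: \<tau>_def\<close>)
  have PhiD: "tau_eval E n (Phi E Fq s f) \<alpha> = \<phi> \<alpha>" and \<phi>_Fqn: "\<phi> \<alpha> \<in> Fqn"
    if \<alpha>: "\<alpha> \<in> Fqn" for \<alpha>
  proof -
    interpret E: field E unfolding E_def using subfield_iff(2)[OF Fqn] .
    have mem: "(\<lambda>i. c i \<otimes> (\<tau> ^^ i) \<alpha>) \<in> {..<n} \<rightarrow> Fqn"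
      using coeff \<tau>_Fqn[OF \<alpha>] subringE(6)[OF subfieldE(1)[OF Fqn]] by auto
    \<comment> \<open>\<open>tau_eval E\<close> sums in the ring with carrier \<open>Fqn\<close>,
      \<open>\<phi>\<close> in \<open>L\<close>; all summands lie in \<open>Fqn\<close>, so the sums
      agree.\<close>
    have *: "finsum E (\<lambda>i. c i \<otimes> (\<tau> ^^ i) \<alpha>) {..<n} = \<phi> \<alpha>"
      unfolding E_def \<phi>_def
      using finsum_subring_consistent[OF subfieldE(1)[OF Fqn] _ mem] by simp
    then show "\<phi> \<alpha> \<in> Fqn" using E.finsum_closed[of _ "{..<n}"] mem by fastforce
    have "tau_eval E n (Phi E Fq s f) \<alpha> = finsum E (\<lambda>i. c i \<otimes> (\<tau> ^^ i) \<alpha>) {..<n}"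
      using \<alpha> \<tau>_Fqn[OF \<alpha>] by (simp add: tau_eval_def Phi_def f) (simp add: E_def)
    with * show "tau_eval E n (Phi E Fq s f) \<alpha> = \<phi> \<alpha>" by simp
  qed

  have "dim Fqs (\<phi> ` carrier L) = ring.dim (L\<lparr>carrier := Fqn\<rparr>) Fq (\<phi> ` Fqn)"
  proof (rule dim_image_eq_dim_image_subfield[OF fin Fq Fqn Fqs])
    show "\<phi> \<in> carrier L \<rightarrow> carrier L"
      unfolding \<phi>_def using coeffL by (auto intro!: finsum_closed)
    show "\<phi> (x \<oplus> y) = \<phi> x \<oplus> \<phi> y" if xy: "x \<in> carrier L" "y \<in> carrier L" for x y
    proof -
      have "\<phi> (x \<oplus> y) = (\<Oplus>i\<in>{..<n}. c i \<otimes> (\<tau> ^^ i) x \<oplus> c i \<otimes> (\<tau> ^^ i) y)"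
        unfolding \<phi>_def using xy coeffL
        by (intro finsum_cong') (auto simp: ring_hom_add[OF \<tau>_pow] r_distr)
      then show ?thesis
        unfolding \<phi>_def using xy coeffL by (simp add: finsum_addf Pi_iff)
    qed
    show "\<phi> (k \<otimes> x) = k \<otimes> \<phi> x" if k: "k \<in> Fqs" and x: "x \<in> carrier L" for k x
    proof -
      have kL: "k \<in> carrier L" using k subfieldE(3)[OF Fqs] by blast
      have "\<phi> (k \<otimes> x) = (\<Oplus>i\<in>{..<n}. k \<otimes> (c i \<otimes> (\<tau> ^^ i) x))"
        unfolding \<phi>_def using x kL coeffL
        by (intro finsum_cong') (auto simp: ring_hom_mult[OF \<tau>_pow] \<tau>_fix[OF k] m_lcomm)
      then show ?thesis
        unfolding \<phi>_def using x kL coeffL by (simp add: finsum_rdistr Pi_iff)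
    qed
  qed (use assms \<phi>_Fqn in auto)
  moreover have "tau_eval L n (Psi L Fq \<sigma>' s f) ` carrier L = \<phi> ` carrier L"
    using PsiD by simp
  moreover have "tau_eval E n (Phi E Fq s f) ` carrier E = \<phi> ` Fqn"
    using PhiD by simp
  ultimately show ?thesis by (simp add: tau_rank_def E_def)
qed

end
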